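(* Let $X$ be a real $n\times p$ matrix, $\hat\Sigma:=X^TX/n$, $\underline\lambda>0$, and for each $j\in\{1,\dots,p\}$ let $\tau_j>0$. Let $\hat\gamma_j(\tau_j)$, $\tilde\tau_j^2(\tau_j)$ and $\hat\Theta_j(\tau_j)$ be the node-wise Lasso, the residual sum of squares plus penalty, and the $j$-th column of the surrogate inverse, as defined in the context. Then for all $j$ $$\|e_j-\hat\Sigma\hat\Theta_j(\tau_j)\|_\infty\le\underline\lambda\,\tau_j/\tilde\tau_j^2(\tau_j),$$ and in fact $$e_{j,j}-\big(\hat\Sigma\hat\Theta_j(\tau_j)\big)_j=0,$$ $$\Big|e_{k,j}-\big(\hat\Sigma\hat\Theta_j(\tau_j)\big)_k\Big|\le\underline\lambda\,\tau_j/\tilde\tau_j^2(\tau_j),\qquad k\ne j .$$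
   Context: For $v\in\mathbb{R}^n$, $\|v\|_n:=\sqrt{v^Tv/n}$. $X_j$ is the $j$-th column of $X$ and $X_{-j}=\{X_k\}_{k\ne j}$ is the $n\times(p-1)$ matrix of the other columns. The node-wise Lasso is (any minimizer) $$\hat\gamma_j(\tau_j):=\arg\min_{\gamma_j\in\mathbb{R}^{p-1}}\{\|X_j-X_{-j}\gamma_j\|_n^2+2\underline\lambda\tau_j\|\gamma_j\|_1\},$$ with entries $\hat\gamma_{k,j}(\tau_j)$, $k\ne j$. Define $\tilde\tau_j^2(\tau_j):=\|X_j-X_{-j}\hat\gamma_j(\tau_j)\|_n^2+\underline\lambda\tau_j\|\hat\gamma_j(\tau_j)\|_1$, assumed nonzero. The vector $\hat\Theta_j(\tau_j)\in\mathbb{R}^p$ has $j$-th entry $1/\tilde\tau_j^2(\tau_j)$ and $k$-th entry $-\hat\gamma_{k,j}(\tau_j)/\tilde\tau_j^2(\tau_j)$ for $k\ne j$. $e_j$ is the $j$-th unit vector of $\mathbb{R}^p$, with $k$-th entry $e_{k,j}$. *)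

theory Defs
  imports "HOL-Analysis.Analysis"
begin

text \<open>
  An \<open>n \<times> p\<close> matrix is \<open>X :: real ^ 'p ^ 'n\<close>, with \<open>n = CARD('n)\<close> and \<open>p = CARD('p)\<close>.
  The coefficient space of the regression of column \<open>j\<close> on the other columns, \<open>\<real>\<close> to the
  power \<open>p - 1\<close> with coordinates indexed by \<open>k \<noteq> j\<close>, is the set of extensional functions
  \<open>(- {j}) \<rightarrow>\<^sub>E UNIV\<close>; the padding value at \<open>j\<close> is never used.
\<close>

definition norm_n :: "real ^ 'n \<Rightarrow> real" where
  "norm_n v = sqrt ((v \<bullet> v) / real CARD('n))"

definition Sigma_hat :: "real ^ 'p ^ 'n \<Rightarrow> real ^ 'p ^ 'p" where
  "Sigma_hat X = (transpose X ** X) /\<^sub>R real CARD('n)"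

definition coeffs :: "'p \<Rightarrow> ('p \<Rightarrow> real) set" where
  "coeffs j = (- {j}) \<rightarrow>\<^sub>E UNIV"

definition mult_others :: "real ^ 'p ^ 'n \<Rightarrow> 'p \<Rightarrow> ('p \<Rightarrow> real) \<Rightarrow> real ^ 'n" where
  "mult_others X j \<gamma> = (\<Sum>k\<in>- {j}. \<gamma> k *\<^sub>R column k X)"

definition l1_norm_others :: "'p::finite \<Rightarrow> ('p \<Rightarrow> real) \<Rightarrow> real" where
  "l1_norm_others j \<gamma> = (\<Sum>k\<in>- {j}. \<bar>\<gamma> k\<bar>)"

definition nodewise_objective ::
    "real ^ 'p ^ 'n \<Rightarrow> real \<Rightarrow> real \<Rightarrow> 'p \<Rightarrow> ('p \<Rightarrow> real) \<Rightarrow> real" where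
  "nodewise_objective X l t j \<gamma> =
     (norm_n (column j X - mult_others X j \<gamma>))\<^sup>2 + 2 * l * t * l1_norm_others j \<gamma>"

text \<open>The minimizer need not be unique, so the node-wise Lasso is a predicate.\<close>

definition is_nodewise_lasso ::
    "real ^ 'p ^ 'n \<Rightarrow> real \<Rightarrow> real \<Rightarrow> 'p \<Rightarrow> ('p \<Rightarrow> real) \<Rightarrow> bool" where
  "is_nodewise_lasso X l t j \<gamma> \<longleftrightarrow>
     is_arg_min (nodewise_objective X l t j) (\<lambda>\<gamma>'. \<gamma>' \<in> coeffs j) \<gamma>"

text \<open>The penalty enters here without the factor 2. The value is the quantity
  written as a square, not its root.\<close>

definition tau_tilde_sq ::
    "real ^ 'p ^ 'n \<Rightarrow> real \<Rightarrow> real \<Rightarrow> 'p \<Rightarrow> ('p \<Rightarrow> real) \<Rightarrow> real" where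
  "tau_tilde_sq X l t j \<gamma> =
     (norm_n (column j X - mult_others X j \<gamma>))\<^sup>2 + l * t * l1_norm_others j \<gamma>"

definition Theta_hat ::
    "real ^ 'p ^ 'n \<Rightarrow> real \<Rightarrow> real \<Rightarrow> 'p \<Rightarrow> ('p \<Rightarrow> real) \<Rightarrow> real ^ 'p" where
  "Theta_hat X l t j \<gamma> =
     (\<chi> k. if k = j then 1 / tau_tilde_sq X l t j \<gamma> else - \<gamma> k / tau_tilde_sq X l t j \<gamma>)"

end

theory Submission
  imports Defs
begin

text \<open>
  The bounds are the Karush--Kuhn--Tucker conditions of the node-wise Lasso. With residual
  \<open>r = X\<^sub>j - X\<^sub>-\<^sub>j \<gamma>\<close>, one has \<open>X \<Theta> = r / T\<close> for \<open>T\<close> the squared \<open>\<tau>\<close>-tilde, so the \<open>k\<close>-th entry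
  of \<open>\<Sigma> \<Theta>\<close> is \<open>X\<^sub>k \<bullet> r / (n T)\<close>. Moving the minimizer \<open>\<gamma>\<close> in the directions
  of the unit vectors \<open>\<plusminus> e\<^sub>k\<close> gives \<open>\<bar>X\<^sub>k \<bullet> r\<bar> / n \<le> \<lambda> \<tau>\<close>; moving it in the directions \<open>\<plusminus> \<gamma>\<close>
  gives \<open>X\<^sub>-\<^sub>j \<gamma> \<bullet> r / n = \<lambda> \<tau> \<parallel>\<gamma>\<parallel>\<^sub>1\<close>, whence \<open>X\<^sub>j \<bullet> r / n = T\<close>.
\<close>

lemma norm_n_power2: "(norm_n (v :: real ^ 'n))\<^sup>2 = (v \<bullet> v) / real CARD('n)"
  by (simp add: norm_n_def)

lemma le_0_if_le_small_multiples:
  fixes x b :: real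
  assumes "\<And>s. 0 < s \<Longrightarrow> s \<le> 1 \<Longrightarrow> x \<le> s * b"
  shows "x \<le> 0"
proof (rule tendsto_lowerbound)
  show "((\<lambda>s. s * b) \<longlongrightarrow> 0) (at_right 0)"
    by (auto intro!: tendsto_eq_intros)
  show "\<forall>\<^sub>F s in at_right 0. x \<le> s * b"
    using eventually_at_right_real[OF zero_less_one] by eventually_elim (auto intro: assms)
qed simp

lemma mult_others_add_scaled:
  "mult_others X j (\<lambda>k. \<gamma> k + s * \<delta> k) = mult_others X j \<gamma> + s *\<^sub>R mult_others X j \<delta>"
  by (simp add: mult_others_def scaleR_add_left sum.distrib scaleR_sum_right)

lemma nodewise_lasso_le:
  assumes "is_nodewise_lasso X l t j \<gamma>"
  shows "nodewise_objective X l t j \<gamma> \<le> nodewise_objective X l t j \<gamma>'"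
proof -
  let ?\<gamma>' = "restrict \<gamma>' (- {j})"
  have "nodewise_objective X l t j ?\<gamma>' = nodewise_objective X l t j \<gamma>'"
    by (simp add: nodewise_objective_def mult_others_def l1_norm_others_def)
  moreover have "?\<gamma>' \<in> coeffs j"
    by (simp add: coeffs_def)
  ultimately show ?thesis
    using assms by (metis is_nodewise_lasso_def is_arg_min_linorder)
qed

lemma nodewise_lasso_directional:
  fixes X :: "real ^ 'p ^ 'n"
  assumes min: "is_nodewise_lasso X l t j \<gamma>" and "l * t \<ge> 0"
    and slope: "\<And>s. 0 < s \<Longrightarrow> s \<le> 1 \<Longrightarrow>
      l1_norm_others j (\<lambda>k. \<gamma> k + s * \<delta> k) \<le> l1_norm_others j \<gamma> + s * a"
  shows "mult_others X j \<delta> \<bullet> (column j X - mult_others X j \<gamma>) / real CARD('n) \<le> l * t * a"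
proof -
  let ?N = "real CARD('n)"
  let ?r = "column j X - mult_others X j \<gamma>"
  let ?D = "mult_others X j \<delta>"
  have "2 * (?D \<bullet> ?r / ?N - l * t * a) \<le> s * (?D \<bullet> ?D / ?N)" if s: "0 < s" "s \<le> 1" for s
  proof -
    let ?\<gamma>' = "\<lambda>k. \<gamma> k + s * \<delta> k"
    have r': "column j X - mult_others X j ?\<gamma>' = ?r - s *\<^sub>R ?D"
      by (simp add: mult_others_add_scaled)
    have "?r \<bullet> ?r / ?N + 2 * (l * t) * l1_norm_others j \<gamma>
        \<le> (?r - s *\<^sub>R ?D) \<bullet> (?r - s *\<^sub>R ?D) / ?N + 2 * (l * t) * l1_norm_others j ?\<gamma>'"
      using nodewise_lasso_le[OF min, of ?\<gamma>']
      by (simp add: nodewise_objective_def norm_n_power2 r' mult.assoc)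
    also have "\<dots> \<le> (?r - s *\<^sub>R ?D) \<bullet> (?r - s *\<^sub>R ?D) / ?N
        + 2 * (l * t) * (l1_norm_others j \<gamma> + s * a)"
      using slope[OF s] \<open>l * t \<ge> 0\<close> by (intro add_left_mono mult_left_mono) auto
    also have "(?r - s *\<^sub>R ?D) \<bullet> (?r - s *\<^sub>R ?D)
        = ?r \<bullet> ?r - 2 * s * (?D \<bullet> ?r) + s * s * (?D \<bullet> ?D)"
      by (simp add: inner_diff_left inner_diff_right inner_commute algebra_simps)
    finally have "s * (2 * (?D \<bullet> ?r / ?N - l * t * a)) \<le> s * (s * (?D \<bullet> ?D / ?N))"
      by (simp add: add_divide_distrib diff_divide_distrib algebra_simps)
    then show ?thesis
      using mult_le_cancel_left_pos[OF s(1)] by blast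
  qed
  then have "2 * (?D \<bullet> ?r / ?N - l * t * a) \<le> 0"
    by (rule le_0_if_le_small_multiples)
  then show ?thesis
    by simp
qed

lemma mult_others_single:
  assumes "k \<noteq> j"
  shows "mult_others X j (\<lambda>i. if i = k then c else 0) = c *\<^sub>R column k X"
  using assms by (simp add: mult_others_def if_distrib[of "\<lambda>x. x *\<^sub>R _"] cong: if_cong)

lemma l1_norm_others_add_single_le:
  assumes "k \<noteq> j" "0 \<le> s" "\<bar>c\<bar> \<le> 1"
  shows "l1_norm_others j (\<lambda>i. \<gamma> i + s * (if i = k then c else 0)) \<le> l1_norm_others j \<gamma> + s"
proof -
  have "\<bar>s * c\<bar> \<le> s"
    using assms mult_left_mono[of "\<bar>c\<bar>" 1 s] by (simp add: abs_mult)
  then have "l1_norm_others j (\<lambda>i. \<gamma> i + s * (if i = k then c else 0))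
      \<le> (\<Sum>i\<in>- {j}. \<bar>\<gamma> i\<bar> + (if i = k then s else 0))"
    unfolding l1_norm_others_def by (intro sum_mono) auto
  also have "\<dots> = l1_norm_others j \<gamma> + s"
    using \<open>k \<noteq> j\<close> by (simp add: sum.distrib l1_norm_others_def)
  finally show ?thesis .
qed

lemma l1_norm_others_scale:
  "l1_norm_others j (\<lambda>k. c * \<gamma> k) = \<bar>c\<bar> * l1_norm_others j \<gamma>"
  by (simp add: l1_norm_others_def abs_mult sum_distrib_left)

lemma mult_others_scale: "mult_others X j (\<lambda>k. c * \<gamma> k) = c *\<^sub>R mult_others X j \<gamma>"
  by (simp add: mult_others_def scaleR_sum_right)

lemma nodewise_lasso_column_inner_residual_le:
  fixes X :: "real ^ 'p ^ 'n"
  assumes "is_nodewise_lasso X l t j \<gamma>" "l * t \<ge> 0" "k \<noteq> j"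
  shows "\<bar>column k X \<bullet> (column j X - mult_others X j \<gamma>) / real CARD('n)\<bar> \<le> l * t"
proof -
  have "c * (column k X \<bullet> (column j X - mult_others X j \<gamma>) / real CARD('n)) \<le> l * t"
    if "\<bar>c\<bar> \<le> 1" for c
    using nodewise_lasso_directional[OF assms(1,2), of "\<lambda>i. if i = k then c else 0" 1]
      l1_norm_others_add_single_le[OF \<open>k \<noteq> j\<close> _ that] mult_others_single[OF \<open>k \<noteq> j\<close>, of X c]
    by simp
  from this[of 1] this[of "-1"] show ?thesis
    by simp
qed

lemma nodewise_lasso_fit_inner_residual:
  fixes X :: "real ^ 'p ^ 'n"
  assumes "is_nodewise_lasso X l t j \<gamma>" "l * t \<ge> 0"
  shows "mult_others X j \<gamma> \<bullet> (column j X - mult_others X j \<gamma>) / real CARD('n)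
    = l * t * l1_norm_others j \<gamma>"
proof -
  have "c * (mult_others X j \<gamma> \<bullet> (column j X - mult_others X j \<gamma>) / real CARD('n))
      \<le> c * (l * t * l1_norm_others j \<gamma>)" if "\<bar>c\<bar> \<le> 1" for c
  proof -
    have "l1_norm_others j (\<lambda>k. \<gamma> k + s * (c * \<gamma> k))
        \<le> l1_norm_others j \<gamma> + s * (c * l1_norm_others j \<gamma>)" if "0 < s" "s \<le> 1" for s
    proof -
      have "\<bar>s * c\<bar> \<le> 1"
        using that \<open>\<bar>c\<bar> \<le> 1\<close> by (simp add: abs_mult mult_le_one)
      then have "\<bar>1 + s * c\<bar> = 1 + s * c"
        by linarith
      then show ?thesis
        using l1_norm_others_scale[of j "1 + s * c" \<gamma>] by (simp add: algebra_simps)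
    qed
    then show ?thesis
      using nodewise_lasso_directional[OF assms, of "\<lambda>k. c * \<gamma> k" "c * l1_norm_others j \<gamma>"]
      by (simp add: mult_others_scale mult.left_commute)
  qed
  from this[of 1] this[of "-1"] show ?thesis
    by simp
qed

lemma tau_tilde_sq_nonneg: "l * t \<ge> 0 \<Longrightarrow> tau_tilde_sq X l t j \<gamma> \<ge> 0"
  by (simp add: tau_tilde_sq_def l1_norm_others_def sum_nonneg)

lemma nodewise_lasso_own_column_inner_residual:
  fixes X :: "real ^ 'p ^ 'n"
  assumes "is_nodewise_lasso X l t j \<gamma>" "l * t \<ge> 0"
  shows "column j X \<bullet> (column j X - mult_others X j \<gamma>) / real CARD('n) = tau_tilde_sq X l t j \<gamma>"
  using nodewise_lasso_fit_inner_residual[OF assms]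
  by (simp add: tau_tilde_sq_def norm_n_power2 inner_diff_left inner_diff_right inner_commute
      diff_divide_distrib add_divide_distrib)

lemma mult_Theta_hat:
  "X *v Theta_hat X l t j \<gamma>
    = (1 / tau_tilde_sq X l t j \<gamma>) *\<^sub>R (column j X - mult_others X j \<gamma>)"
proof -
  let ?T = "tau_tilde_sq X l t j \<gamma>"
  have "X *v Theta_hat X l t j \<gamma> = (\<Sum>k\<in>UNIV. Theta_hat X l t j \<gamma> $ k *\<^sub>R column k X)"
    by (simp add: matrix_mult_sum scalar_mult_eq_scaleR)
  also have "\<dots> = (1 / ?T) *\<^sub>R column j X + (\<Sum>k\<in>- {j}. (- \<gamma> k / ?T) *\<^sub>R column k X)"
    by (subst sum.remove[of _ j]) (auto simp: Theta_hat_def Compl_eq_Diff_UNIV intro!: sum.cong)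
  also have "\<dots> = (1 / ?T) *\<^sub>R (column j X - mult_others X j \<gamma>)"
    by (simp add: mult_others_def scaleR_diff_right scaleR_sum_right sum_negf)
  finally show ?thesis .
qed

lemma Sigma_hat_mult_nth:
  fixes X :: "real ^ 'p ^ 'n"
  shows "(Sigma_hat X *v v) $ k = column k X \<bullet> (X *v v) / real CARD('n)"
proof -
  have "Sigma_hat X *v v = (transpose X *v (X *v v)) /\<^sub>R real CARD('n)"
    by (simp add: Sigma_hat_def scaleR_matrix_vector_assoc[symmetric] matrix_vector_mul_assoc)
  moreover have "(transpose X *v (X *v v)) $ k = column k X \<bullet> (X *v v)"
    by (simp add: matrix_vector_mul_component transpose_def column_def)
  ultimately show ?thesis
    by (simp add: divide_inverse_commute)
qed

lemma infnorm_le_cart: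
  fixes v :: "real ^ 'n"
  assumes "\<And>i. \<bar>v $ i\<bar> \<le> b"
  shows "infnorm v \<le> b"
  unfolding infnorm_Max using assms by (auto simp: Basis_vec_def inner_axis)

theorem lemma2p3p1:
  fixes X :: "real ^ 'p ^ 'n"
    and l :: real
    and \<tau> :: "'p \<Rightarrow> real"
    and \<gamma> :: "'p \<Rightarrow> 'p \<Rightarrow> real"
  assumes "l > 0"
    and "\<And>j. \<tau> j > 0"
    and "\<And>j. is_nodewise_lasso X l (\<tau> j) j (\<gamma> j)"
  shows "\<forall>j. tau_tilde_sq X l (\<tau> j) j (\<gamma> j) \<noteq> 0 \<longrightarrow>
    infnorm (axis j 1 - Sigma_hat X *v Theta_hat X l (\<tau> j) j (\<gamma> j))
        \<le> l * \<tau> j / tau_tilde_sq X l (\<tau> j) j (\<gamma> j)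
    \<and> axis j 1 $ j - (Sigma_hat X *v Theta_hat X l (\<tau> j) j (\<gamma> j)) $ j = 0
    \<and> (\<forall>k. k \<noteq> j \<longrightarrow>
        \<bar>axis j 1 $ k - (Sigma_hat X *v Theta_hat X l (\<tau> j) j (\<gamma> j)) $ k\<bar>
          \<le> l * \<tau> j / tau_tilde_sq X l (\<tau> j) j (\<gamma> j))"
proof (intro allI impI)
  fix j
  let ?T = "tau_tilde_sq X l (\<tau> j) j (\<gamma> j)"
  let ?v = "Sigma_hat X *v Theta_hat X l (\<tau> j) j (\<gamma> j)"
  let ?r = "column j X - mult_others X j (\<gamma> j)"
  assume "?T \<noteq> 0"
  have lt: "l * \<tau> j \<ge> 0"
    using assms(1) assms(2)[of j] by simp
  have T: "?T > 0"
    using tau_tilde_sq_nonneg[OF lt, of X j "\<gamma> j"] \<open>?T \<noteq> 0\<close> by simp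
  have v: "?v $ k = (column k X \<bullet> ?r / real CARD('n)) / ?T" for k
    by (simp add: Sigma_hat_mult_nth mult_Theta_hat)
  have diag: "axis j 1 $ j - ?v $ j = 0"
    using nodewise_lasso_own_column_inner_residual[OF assms(3)[of j] lt] T
    unfolding v by simp
  have off: "\<bar>axis j 1 $ k - ?v $ k\<bar> \<le> l * \<tau> j / ?T" if "k \<noteq> j" for k
  proof -
    have "\<bar>axis j 1 $ k - ?v $ k\<bar> = \<bar>column k X \<bullet> ?r / real CARD('n)\<bar> / ?T"
      unfolding v using that T by (simp add: axis_def)
    also have "\<dots> \<le> l * \<tau> j / ?T"
      using nodewise_lasso_column_inner_residual_le[OF assms(3)[of j] lt that] T
      by (intro divide_right_mono) auto
    finally show ?thesis .
  qed
  have "\<bar>(axis j 1 - ?v) $ k\<bar> \<le> l * \<tau> j / ?T" for k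
    using diag off[of k] lt T by (cases "k = j") auto
  then have "infnorm (axis j 1 - ?v) \<le> l * \<tau> j / ?T"
    by (rule infnorm_le_cart)
  with diag off show "infnorm (axis j 1 - ?v) \<le> l * \<tau> j / ?T
    \<and> axis j 1 $ j - ?v $ j = 0
    \<and> (\<forall>k. k \<noteq> j \<longrightarrow> \<bar>axis j 1 $ k - ?v $ k\<bar> \<le> l * \<tau> j / ?T)"
    by blast
qed

end
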